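(* $c$ is weakly concave on $\Lambda$ if $\nu\le 2$, $e_{(3)}\ne 0.5$ and $$\underline{\lambda}_i>\theta_i\,\frac{e_{(3)}}{1-2e_{(3)}},\qquad\forall i\in[N].$$
   Context: Fix an integer $N\ge 1$ and write $[N]=\{1,\dots,N\}$. Costs $c_{(i)}>0$ and $c_{(i,j)}>0$ ($i,j\in[N]$) are given with $c_{(i)}=c_{(i,i)}\le c_{(i,j)}=c_{(j,i)}$ for all $i,j\in[N]$. The parameters satisfy $0<\theta_1\le\theta_2\le\dots\le\theta_N$, and $\nu:=\theta_N/\theta_1>1$. The domain is the box $\Lambda=[\underline{\boldsymbol{\lambda}},\overline{\boldsymbol{\lambda}}]=\{\boldsymbol{\lambda}\in\mathbb{R}^N:\underline{\lambda}_i\le\lambda_i\le\overline{\lambda}_i\ \forall i\}$ with $\underline{\lambda}_i>0$ for all $i$. For $\boldsymbol{\lambda}\in\Lambda$, $c(\boldsymbol{\lambda})$ is the optimal value of the linear program in variables $\boldsymbol{x}=(x_{i,j})_{i,j\in[N]}$, $\boldsymbol{y}=(y_i)_{i\in[N]}$: minimize $\sum_{i,j\in[N]}c_{(i,j)}x_{i,j}+\sum_{i\in[N]}c_{(i)}y_i$ subject to $\sum_{j\in[N]}x_{j,i}+\sum_{j\in[N]}x_{i,j}+y_i=\lambda_i$ for all $i\in[N]$; $\theta_i x_{i,j}\le\lambda_j y_i$ for all $i,j\in[N]$; $x_{i,j}\ge 0$ for all $i,j\in[N]$; $y_i\ge 0$ for all $i\in[N]$. Weak concavity: $c$ is weakly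 concave on $\Lambda$ if there exists a finite $\rho\ge 0$ such that $\boldsymbol{\lambda}\mapsto c(\boldsymbol{\lambda})-\rho\|\boldsymbol{\lambda}\|^2/2$ is concave on $\Lambda$, with $\|\cdot\|$ the Euclidean norm. Matching efficiency: $e_{i,j}=1-c_{(i,j)}/(c_{(i)}+c_{(j)})$ for $i,j\in[N]$ (so $e_{i,i}=0.5$ and $e_{i,j}\le 0.5$). For each $i$, let $e_{i,(1)}\ge e_{i,(2)}\ge\dots\ge e_{i,(N)}$ be the values $e_{i,1},\dots,e_{i,N}$ sorted in descending order. For a positive integer $k$, the $k$-th critical matching efficiency is $e_{(k)}=\max_{i\in[N]}e_{i,(k)}$ if $k\le N$, and $e_{(k)}=0$ if $k>N$. *)

theory Defs
  imports "HOL-Analysis.Analysis"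
begin

text \<open>
  The index set \<open>{1, \<dots>, N}\<close> is rendered by a finite linearly ordered type \<open>'n\<close> with
  \<open>N = CARD('n)\<close>; its least and greatest elements \<open>Min UNIV\<close> and \<open>Max UNIV\<close> play the roles
  of \<open>1\<close> and \<open>N\<close>. Costs: \<open>c1 i\<close> is \<open>c_(i)\<close> and \<open>c2 i j\<close> is \<open>c_(i,j)\<close>.
\<close>

definition lp_feasible ::
    "('n::finite \<Rightarrow> real) \<Rightarrow> real^'n \<Rightarrow> ('n \<Rightarrow> 'n \<Rightarrow> real) \<Rightarrow> ('n \<Rightarrow> real) \<Rightarrow> bool" where
  "lp_feasible \<theta> l x y \<longleftrightarrow>
     (\<forall>i. (\<Sum>j\<in>UNIV. x j i) + (\<Sum>j\<in>UNIV. x i j) + y i = l $ i) \<and>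
     (\<forall>i j. \<theta> i * x i j \<le> l $ j * y i) \<and>
     (\<forall>i j. 0 \<le> x i j) \<and>
     (\<forall>i. 0 \<le> y i)"

definition lp_objective ::
    "('n::finite \<Rightarrow> real) \<Rightarrow> ('n \<Rightarrow> 'n \<Rightarrow> real) \<Rightarrow> ('n \<Rightarrow> 'n \<Rightarrow> real) \<Rightarrow> ('n \<Rightarrow> real) \<Rightarrow> real" where
  "lp_objective c1 c2 x y = (\<Sum>i\<in>UNIV. \<Sum>j\<in>UNIV. c2 i j * x i j) + (\<Sum>i\<in>UNIV. c1 i * y i)"

text \<open>
  For nonnegative costs and \<open>l \<ge> 0\<close> the feasible set is compact and contains \<open>x = 0\<close>, \<open>y = l\<close>,
  so the infimum below is the attained minimum.
\<close>

definition lp_value ::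
    "('n::finite \<Rightarrow> real) \<Rightarrow> ('n \<Rightarrow> 'n \<Rightarrow> real) \<Rightarrow> ('n \<Rightarrow> real) \<Rightarrow> real^'n \<Rightarrow> real" where
  "lp_value c1 c2 \<theta> l = Inf {lp_objective c1 c2 x y | x y. lp_feasible \<theta> l x y}"

definition weakly_concave_on :: "'a::real_inner set \<Rightarrow> ('a \<Rightarrow> real) \<Rightarrow> bool" where
  "weakly_concave_on S f \<longleftrightarrow> (\<exists>\<rho>\<ge>0. concave_on S (\<lambda>v. f v - \<rho> * (norm v)\<^sup>2 / 2))"

definition efficiency :: "('n \<Rightarrow> real) \<Rightarrow> ('n \<Rightarrow> 'n \<Rightarrow> real) \<Rightarrow> 'n \<Rightarrow> 'n \<Rightarrow> real" where
  "efficiency c1 c2 i j = 1 - c2 i j / (c1 i + c1 j)"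

text \<open>
  The \<open>k\<close>-th largest efficiency of \<open>i\<close>, counted with multiplicity, for \<open>1 \<le> k \<le> CARD('n)\<close>;
  list positions start at 0.
\<close>

definition sorted_efficiency ::
    "('n::finite \<Rightarrow> real) \<Rightarrow> ('n \<Rightarrow> 'n \<Rightarrow> real) \<Rightarrow> 'n \<Rightarrow> nat \<Rightarrow> real" where
  "sorted_efficiency c1 c2 i k =
     rev (sorted_list_of_multiset (image_mset (efficiency c1 c2 i) (mset_set UNIV))) ! (k - 1)"

definition critical_efficiency ::
    "('n::finite \<Rightarrow> real) \<Rightarrow> ('n \<Rightarrow> 'n \<Rightarrow> real) \<Rightarrow> nat \<Rightarrow> real" where
  "critical_efficiency c1 c2 k =
     (if k \<le> CARD('n) then Max (range (\<lambda>i. sorted_efficiency c1 c2 i k)) else 0)"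

end

theory Submission
  imports Defs
begin

text \<open>
  In the dual program, \<open>\<alpha> i\<close> is at most the price of \<open>i\<close> when it is matched only with itself, and
  the lower bound on \<open>\<lambda>\<close> makes these prices so small that a pair with efficiency at most \<open>e\<^sub>(\<^sub>3\<^sub>)\<close>
  is never worth matching. Every index has at most one other partner above this threshold, so an
  optimal policy matches at full capacity inside the blocks of some partition into singletons
  and pairs; \<open>\<nu> \<le> 2\<close> ensures that both members of a pair still also match with themselves. The
  cost of matching at full capacity inside the blocks of a fixed partition is a smooth rational
  function of \<open>\<lambda>\<close>. Hence \<open>c\<close> is a minimum of finitely many smooth functions on a compact box.
\<close>

section \<open>Functions with a uniform quadratic Taylor estimate\<close>

text \<open>The Lipschitz clause is what makes this class closed under products and inverses: it
  renders a product of two increments quadratic. The constants are uniform on \<open>S\<close>,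
  while \<open>g\<close> may be any function, so differentiability is never mentioned.\<close>

definition quad_approx_on :: "'a::real_inner set \<Rightarrow> ('a \<Rightarrow> real) \<Rightarrow> bool" where
  "quad_approx_on S f \<longleftrightarrow> (\<exists>A L R g. \<forall>x\<in>S. \<bar>f x\<bar> \<le> A \<and>
     (\<forall>y\<in>S. \<bar>f y - f x\<bar> \<le> L * norm (y - x) \<and>
       \<bar>f y - f x - g x \<bullet> (y - x)\<bar> \<le> R * (norm (y - x))\<^sup>2))"

lemma quad_approx_onI:
  assumes "\<And>x. x \<in> S \<Longrightarrow> \<bar>f x\<bar> \<le> A"
    and "\<And>x y. x \<in> S \<Longrightarrow> y \<in> S \<Longrightarrow> \<bar>f y - f x\<bar> \<le> L * norm (y - x)"
    and "\<And>x y. x \<in> S \<Longrightarrow> y \<in> S \<Longrightarrow> \<bar>f y - f x - g x \<bullet> (y - x)\<bar> \<le> R * (norm (y - x))\<^sup>2"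
  shows "quad_approx_on S f"
  unfolding quad_approx_on_def using assms by blast

lemma quad_approx_onE:
  assumes "quad_approx_on S f"
  obtains A L R g where "0 \<le> A" "0 \<le> L" "0 \<le> R"
    and "\<And>x. x \<in> S \<Longrightarrow> \<bar>f x\<bar> \<le> A"
    and "\<And>x y. x \<in> S \<Longrightarrow> y \<in> S \<Longrightarrow> \<bar>f y - f x\<bar> \<le> L * norm (y - x)"
    and "\<And>x y. x \<in> S \<Longrightarrow> y \<in> S \<Longrightarrow> \<bar>f y - f x - g x \<bullet> (y - x)\<bar> \<le> R * (norm (y - x))\<^sup>2"
proof -
  obtain A L R g where *: "\<forall>x\<in>S. \<bar>f x\<bar> \<le> A \<and> (\<forall>y\<in>S. \<bar>f y - f x\<bar> \<le> L * norm (y - x) \<and>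
       \<bar>f y - f x - g x \<bullet> (y - x)\<bar> \<le> R * (norm (y - x))\<^sup>2)"
    using assms unfolding quad_approx_on_def by blast
  have 1: "A \<le> \<bar>A\<bar>" by simp
  have 2: "L * norm z \<le> \<bar>L\<bar> * norm z" for z :: 'a by (simp add: mult_right_mono)
  have 3: "R * (norm z)\<^sup>2 \<le> \<bar>R\<bar> * (norm z)\<^sup>2" for z :: 'a by (simp add: mult_right_mono)
  show thesis
    by (rule that[of "\<bar>A\<bar>" "\<bar>L\<bar>" "\<bar>R\<bar>" g])
      (use * 1 order_trans[OF _ 2] order_trans[OF _ 3] order_trans[OF _ 1] in \<open>simp_all del: abs_le_iff\<close>)
qed

lemma quad_approx_on_const: "quad_approx_on S (\<lambda>_. k)"
  by (rule quad_approx_onI[where A = "\<bar>k\<bar>" and L = 0 and R = 0 and g = "\<lambda>_. 0"]) auto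

lemma quad_approx_on_inner:
  assumes "bounded S"
  shows "quad_approx_on S (\<lambda>x. u \<bullet> x)"
proof -
  obtain D where D: "\<And>x. x \<in> S \<Longrightarrow> norm x \<le> D"
    using assms unfolding bounded_iff by blast
  show ?thesis
  proof (rule quad_approx_onI[where A = "norm u * D" and L = "norm u" and R = 0 and g = "\<lambda>_. u"])
    fix x assume "x \<in> S"
    then show "\<bar>u \<bullet> x\<bar> \<le> norm u * D"
      by (meson Cauchy_Schwarz_ineq2 D mult_left_mono norm_ge_zero order_trans)
  next
    fix x y
    show "\<bar>u \<bullet> y - u \<bullet> x\<bar> \<le> norm u * norm (y - x)"
      by (metis Cauchy_Schwarz_ineq2 inner_diff_right)
  qed (simp add: inner_diff_right)
qed

lemma quad_approx_on_add:
  assumes "quad_approx_on S f" "quad_approx_on S h"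
  shows "quad_approx_on S (\<lambda>x. f x + h x)"
proof -
  obtain A L R g where f: "\<And>x. x \<in> S \<Longrightarrow> \<bar>f x\<bar> \<le> A"
    "\<And>x y. x \<in> S \<Longrightarrow> y \<in> S \<Longrightarrow> \<bar>f y - f x\<bar> \<le> L * norm (y - x)"
    "\<And>x y. x \<in> S \<Longrightarrow> y \<in> S \<Longrightarrow> \<bar>f y - f x - g x \<bullet> (y - x)\<bar> \<le> R * (norm (y - x))\<^sup>2"
    by (rule quad_approx_onE[OF assms(1)]) blast
  obtain A' L' R' g' where h: "\<And>x. x \<in> S \<Longrightarrow> \<bar>h x\<bar> \<le> A'"
    "\<And>x y. x \<in> S \<Longrightarrow> y \<in> S \<Longrightarrow> \<bar>h y - h x\<bar> \<le> L' * norm (y - x)"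
    "\<And>x y. x \<in> S \<Longrightarrow> y \<in> S \<Longrightarrow> \<bar>h y - h x - g' x \<bullet> (y - x)\<bar> \<le> R' * (norm (y - x))\<^sup>2"
    by (rule quad_approx_onE[OF assms(2)]) blast
  show ?thesis
  proof (rule quad_approx_onI[where A = "A + A'" and L = "L + L'" and R = "R + R'"
        and g = "\<lambda>x. g x + g' x"], goal_cases)
    case (1 x)
    then show ?case using f(1)[of x] h(1)[of x] by linarith
  next
    case (2 x y)
    then show ?case using f(2)[of x y] h(2)[of x y] by (auto simp: distrib_right)
  next
    case (3 x y)
    then show ?case using f(3)[of x y] h(3)[of x y] by (auto simp: distrib_right inner_add_left)
  qed
qed

lemma quad_approx_on_mult:
  assumes "quad_approx_on S f" "quad_approx_on S h"
  shows "quad_approx_on S (\<lambda>x. f x * h x)"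
proof -
  obtain A L R g where nn: "0 \<le> A" "0 \<le> L" "0 \<le> R" and f: "\<And>x. x \<in> S \<Longrightarrow> \<bar>f x\<bar> \<le> A"
    "\<And>x y. x \<in> S \<Longrightarrow> y \<in> S \<Longrightarrow> \<bar>f y - f x\<bar> \<le> L * norm (y - x)"
    "\<And>x y. x \<in> S \<Longrightarrow> y \<in> S \<Longrightarrow> \<bar>f y - f x - g x \<bullet> (y - x)\<bar> \<le> R * (norm (y - x))\<^sup>2"
    by (rule quad_approx_onE[OF assms(1)]) blast
  obtain A' L' R' g' where nn': "0 \<le> A'" "0 \<le> L'" "0 \<le> R'" and h: "\<And>x. x \<in> S \<Longrightarrow> \<bar>h x\<bar> \<le> A'"
    "\<And>x y. x \<in> S \<Longrightarrow> y \<in> S \<Longrightarrow> \<bar>h y - h x\<bar> \<le> L' * norm (y - x)"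
    "\<And>x y. x \<in> S \<Longrightarrow> y \<in> S \<Longrightarrow> \<bar>h y - h x - g' x \<bullet> (y - x)\<bar> \<le> R' * (norm (y - x))\<^sup>2"
    by (rule quad_approx_onE[OF assms(2)]) blast
  show ?thesis
  proof (rule quad_approx_onI[where A = "A * A'" and L = "A * L' + A' * L"
        and R = "A * R' + A' * R + L * L'" and g = "\<lambda>x. f x *\<^sub>R g' x + h x *\<^sub>R g x"], goal_cases)
    case (1 x)
    then show ?case using f(1)[of x] h(1)[of x] nn by (simp add: abs_mult mult_mono)
  next
    case (2 x y)
    have "f y * h y - f x * h x = f y * (h y - h x) + h x * (f y - f x)" by algebra
    also have "\<bar>\<dots>\<bar> \<le> \<bar>f y\<bar> * \<bar>h y - h x\<bar> + \<bar>h x\<bar> * \<bar>f y - f x\<bar>"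
      by (metis abs_mult abs_triangle_ineq)
    also have "\<dots> \<le> A * (L' * norm (y - x)) + A' * (L * norm (y - x))"
      using 2 f h nn nn' by (intro add_mono mult_mono) auto
    finally show ?case by (simp add: algebra_simps)
  next
    case (3 x y)
    let ?d = "y - x"
    define r where "r = f y - f x - g x \<bullet> ?d"
    define s where "s = h y - h x - g' x \<bullet> ?d"
    have r: "\<bar>r\<bar> \<le> R * (norm ?d)\<^sup>2" and s: "\<bar>s\<bar> \<le> R' * (norm ?d)\<^sup>2"
      using 3 f(3) h(3) unfolding r_def s_def by auto
    have "f y * h y - f x * h x - (f x *\<^sub>R g' x + h x *\<^sub>R g x) \<bullet> ?d
        = f x * s + h x * r + (f y - f x) * (h y - h x)"
      unfolding r_def s_def inner_add_left inner_scaleR_left by algebra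
    also have "\<bar>\<dots>\<bar> \<le> \<bar>f x\<bar> * \<bar>s\<bar> + \<bar>h x\<bar> * \<bar>r\<bar> + \<bar>f y - f x\<bar> * \<bar>h y - h x\<bar>"
      unfolding abs_mult[symmetric] by linarith
    also have "\<dots> \<le> A * (R' * (norm ?d)\<^sup>2) + A' * (R * (norm ?d)\<^sup>2) + (L * norm ?d) * (L' * norm ?d)"
      using 3 f h nn nn' r s by (intro add_mono mult_mono) auto
    finally show ?case by (simp add: algebra_simps power2_eq_square)
  qed
qed

lemma quad_approx_on_inverse:
  assumes "quad_approx_on S f" and m: "0 < m" "\<And>x. x \<in> S \<Longrightarrow> m \<le> f x"
  shows "quad_approx_on S (\<lambda>x. inverse (f x))"
proof -
  obtain A L R g where nn: "0 \<le> A" "0 \<le> L" "0 \<le> R" and f: "\<And>x. x \<in> S \<Longrightarrow> \<bar>f x\<bar> \<le> A"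
    "\<And>x y. x \<in> S \<Longrightarrow> y \<in> S \<Longrightarrow> \<bar>f y - f x\<bar> \<le> L * norm (y - x)"
    "\<And>x y. x \<in> S \<Longrightarrow> y \<in> S \<Longrightarrow> \<bar>f y - f x - g x \<bullet> (y - x)\<bar> \<le> R * (norm (y - x))\<^sup>2"
    by (rule quad_approx_onE[OF assms(1)]) blast
  have pos: "0 < f x" if "x \<in> S" for x using m that by force
  have inv: "\<bar>inverse (f x)\<bar> \<le> inverse m" if "x \<in> S" for x
    using m pos[OF that] that by (simp add: le_imp_inverse_le)
  show ?thesis
  proof (rule quad_approx_onI[where A = "inverse m" and L = "L * inverse m * inverse m"
        and R = "(L * L * inverse m + R) * inverse m * inverse m"
        and g = "\<lambda>x. - (inverse (f x))\<^sup>2 *\<^sub>R g x"], goal_cases)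
    case (1 x)
    then show ?case by (rule inv)
  next
    case (2 x y)
    have "inverse (f y) - inverse (f x) = - (f y - f x) * inverse (f y) * inverse (f x)"
      using pos[OF 2(1)] pos[OF 2(2)] by (simp add: field_simps)
    then have "\<bar>inverse (f y) - inverse (f x)\<bar> = \<bar>f y - f x\<bar> * \<bar>inverse (f y)\<bar> * \<bar>inverse (f x)\<bar>"
      by (simp only: abs_mult abs_minus_cancel)
    also have "\<dots> \<le> (L * norm (y - x)) * inverse m * inverse m"
      using 2 f inv nn m by (intro mult_mono) auto
    finally show ?case by (simp add: algebra_simps)
  next
    case (3 x y)
    let ?d = "y - x"
    define r where "r = f y - f x - g x \<bullet> ?d"
    have r: "\<bar>r\<bar> \<le> R * (norm ?d)\<^sup>2"
      using 3 f(3) unfolding r_def by auto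
    have gd: "g x \<bullet> ?d = f y - f x - r" by (simp add: r_def)
    \<comment> \<open>With \<open>d = f y - f x\<close>, the exact remainder of the reciprocal is
      \<open>1/f y - 1/f x + d/(f x)^2 = d^2/(f y * (f x)^2)\<close>; \<open>r\<close> appears
      because the linear term is \<open>d - r\<close>.\<close>
    have "inverse (f y) - inverse (f x) - (- (inverse (f x))\<^sup>2 *\<^sub>R g x) \<bullet> ?d
        = ((f y - f x) * (f y - f x) * inverse (f y) - r) * inverse (f x) * inverse (f x)"
      unfolding inner_scaleR_left gd using pos[OF 3(1)] pos[OF 3(2)]
      by (simp add: field_simps power2_eq_square)
    also have "\<bar>\<dots>\<bar> = \<bar>(f y - f x) * (f y - f x) * inverse (f y) - r\<bar>
        * \<bar>inverse (f x)\<bar> * \<bar>inverse (f x)\<bar>"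
      by (simp only: abs_mult)
    also have "\<dots> \<le> (\<bar>f y - f x\<bar> * \<bar>f y - f x\<bar> * \<bar>inverse (f y)\<bar> + \<bar>r\<bar>)
        * \<bar>inverse (f x)\<bar> * \<bar>inverse (f x)\<bar>"
      using abs_triangle_ineq4[of "(f y - f x) * (f y - f x) * inverse (f y)" r]
      by (intro mult_right_mono) (simp_all only: abs_mult abs_ge_zero)
    also have "\<dots> \<le> ((L * norm ?d) * (L * norm ?d) * inverse m + R * (norm ?d)\<^sup>2)
        * inverse m * inverse m"
      using 3 f inv nn m r by (intro mult_mono add_mono) auto
    finally show ?case by (simp add: algebra_simps power2_eq_square)
  qed
qed

lemma quad_approx_on_sum:
  assumes "\<And>i. i \<in> I \<Longrightarrow> quad_approx_on S (f i)"
  shows "quad_approx_on S (\<lambda>x. \<Sum>i\<in>I. f i x)"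
  using assms
  by (induction I rule: infinite_finite_induct)
    (auto intro: quad_approx_on_const quad_approx_on_add)

section \<open>Weak concavity of finite minima\<close>

lemma concave_on_if_supergradient:
  fixes h :: "'a::real_inner \<Rightarrow> real"
  assumes S: "convex S"
    and G: "\<And>x y. x \<in> S \<Longrightarrow> y \<in> S \<Longrightarrow> h y \<le> h x + G x \<bullet> (y - x)"
  shows "concave_on S h"
  unfolding concave_on_iff
proof (intro conjI S ballI allI impI)
  fix x y and u v :: real
  assume xy: "x \<in> S" "y \<in> S" and u: "0 \<le> u" "0 \<le> v" "u + v = 1"
  \<comment> \<open>The supergradient is taken at the convex combination itself, so that the
    weighted linear terms cancel.\<close>
  define z where "z = u *\<^sub>R x + v *\<^sub>R y"
  have z: "z \<in> S" unfolding z_def using S xy u by (simp add: convex_def)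
  have "u * h x + v * h y \<le> u * (h z + G z \<bullet> (x - z)) + v * (h z + G z \<bullet> (y - z))"
    using G[OF z xy(1)] G[OF z xy(2)] u by (intro add_mono mult_left_mono) auto
  also have "\<dots> = (u + v) * h z + G z \<bullet> ((u *\<^sub>R x + v *\<^sub>R y) - (u + v) *\<^sub>R z)"
    by (simp add: algebra_simps inner_simps)
  also have "\<dots> = h z" by (simp add: u z_def)
  finally show "h (u *\<^sub>R x + v *\<^sub>R y) \<ge> u * h x + v * h y" unfolding z_def .
qed

text \<open>An \<open>f k\<close> attaining the minimum at \<open>x\<close> lies above
  \<open>c\<close> and touches it at \<open>x\<close>, so its Taylor estimate bounds
  \<open>c\<close> from above. Subtracting a large multiple of the squared norm absorbs the
  quadratic error and leaves a supergradient, however irregularly the active index varies with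
  \<open>x\<close>.\<close>

lemma weakly_concave_on_finite_min:
  fixes c :: "'a::real_inner \<Rightarrow> real"
  assumes S: "convex S" and fin: "finite I"
    and f: "\<And>k. k \<in> I \<Longrightarrow> quad_approx_on S (f k)"
    and le: "\<And>k x. k \<in> I \<Longrightarrow> x \<in> S \<Longrightarrow> c x \<le> f k x"
    and eq: "\<And>x. x \<in> S \<Longrightarrow> \<exists>k\<in>I. c x = f k x"
  shows "weakly_concave_on S c"
proof -
  have "\<exists>R g. 0 \<le> R \<and> (\<forall>x\<in>S. \<forall>y\<in>S. f k y \<le> f k x + g x \<bullet> (y - x) + R * (norm (y - x))\<^sup>2)"
    if k: "k \<in> I" for k
    by (rule quad_approx_onE[OF f[OF k]]) (smt (verit))
  then obtain R g where R: "\<And>k. k \<in> I \<Longrightarrow> 0 \<le> R k"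
    and g: "\<And>k x y. k \<in> I \<Longrightarrow> x \<in> S \<Longrightarrow> y \<in> S \<Longrightarrow>
        f k y \<le> f k x + g k x \<bullet> (y - x) + R k * (norm (y - x))\<^sup>2"
    by metis
  define M where "M = (\<Sum>k\<in>I. R k)"
  have M: "R k \<le> M" if "k \<in> I" for k
    unfolding M_def using fin R that by (intro member_le_sum) auto
  have M0: "0 \<le> M" unfolding M_def using R by (simp add: sum_nonneg)
  obtain K where K: "\<And>x. x \<in> S \<Longrightarrow> K x \<in> I" "\<And>x. x \<in> S \<Longrightarrow> c x = f (K x) x"
    using eq by metis
  \<comment> \<open>The modulus is \<open>2 * M\<close> because weak concavity subtracts half of it
    times the squared norm.\<close>
  have "concave_on S (\<lambda>v. c v - (2 * M) * (norm v)\<^sup>2 / 2)"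
  proof (rule concave_on_if_supergradient[OF S, where G = "\<lambda>x. g (K x) x - (2 * M) *\<^sub>R x"])
    fix x y assume xy: "x \<in> S" "y \<in> S"
    have n: "(norm y)\<^sup>2 = (norm x)\<^sup>2 + 2 * (x \<bullet> (y - x)) + (norm (y - x))\<^sup>2"
      by (simp add: power2_norm_eq_inner inner_simps inner_commute)
    have "c y \<le> f (K x) y" using le K xy by blast
    also have "\<dots> \<le> c x + g (K x) x \<bullet> (y - x) + R (K x) * (norm (y - x))\<^sup>2"
      using g K xy by simp
    also have "\<dots> \<le> c x + g (K x) x \<bullet> (y - x) + M * (norm (y - x))\<^sup>2"
      using M K xy by (simp add: mult_right_mono)
    finally show "c y - 2 * M * (norm y)\<^sup>2 / 2
        \<le> c x - 2 * M * (norm x)\<^sup>2 / 2 + (g (K x) x - (2 * M) *\<^sub>R x) \<bullet> (y - x)"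
      unfolding n by (simp add: inner_diff_left distrib_left add_divide_distrib)
  qed
  then show ?thesis unfolding weakly_concave_on_def
    using M0 by (intro exI[of _ "2 * M"]) auto
qed

section \<open>Policies and duality\<close>

text \<open>A partition is given by the map sending an element to its block.\<close>

definition block_map :: "('n \<Rightarrow> 'n set) \<Rightarrow> bool" where
  "block_map K \<longleftrightarrow> (\<forall>i. i \<in> K i \<and> (\<forall>j\<in>K i. K j = K i))"

text \<open>
  Matching within the blocks of \<open>K\<close> at full capacity, \<open>x i j = l $ j * z i\<close> and \<open>y i = \<theta> i * z i\<close>,
  turns the balance equation of \<open>i\<close> into \<open>(\<theta> i + L) * z i + l $ i * (\<Sum>j\<in>K i. z j) = l $ i\<close> with
  \<open>L\<close> the block total of \<open>l\<close>; \<open>block_rate\<close> is its solution \<open>z\<close>.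
\<close>

definition block_rate :: "('n::finite \<Rightarrow> real) \<Rightarrow> ('n \<Rightarrow> 'n set) \<Rightarrow> real^'n \<Rightarrow> 'n \<Rightarrow> real" where
  "block_rate \<theta> K l i = l $ i * inverse (\<theta> i + (\<Sum>j\<in>K i. l $ j)) *
     inverse (1 + (\<Sum>k\<in>K i. l $ k * inverse (\<theta> k + (\<Sum>j\<in>K i. l $ j))))"

definition block_cost ::
    "('n::finite \<Rightarrow> real) \<Rightarrow> ('n \<Rightarrow> 'n \<Rightarrow> real) \<Rightarrow> ('n \<Rightarrow> real) \<Rightarrow> ('n \<Rightarrow> 'n set) \<Rightarrow> real^'n \<Rightarrow> real" where
  "block_cost c1 c2 \<theta> K l =
     (\<Sum>i\<in>UNIV. block_rate \<theta> K l i * (\<theta> i * c1 i + (\<Sum>j\<in>K i. c2 i j * l $ j)))"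

lemma block_map_sym: "block_map K \<Longrightarrow> j \<in> K i \<longleftrightarrow> i \<in> K j"
  unfolding block_map_def by blast

lemma block_rate_nonneg:
  assumes "\<And>i. 0 < \<theta> i" "\<And>i. 0 < l $ i"
  shows "0 \<le> block_rate \<theta> K l i"
  unfolding block_rate_def using assms
  by (intro mult_nonneg_nonneg) (auto simp: less_imp_le intro!: sum_nonneg add_nonneg_nonneg mult_nonneg_nonneg)

text \<open>All members of a block share the total \<open>L\<close>. With \<open>Z\<close> the sum
  of the rates over the block, the equation reads
  \<open>z i = l $ i * (1 - Z) / (\<theta> i + L)\<close>; summing gives
  \<open>Z = T * (1 - Z)\<close>, hence \<open>1 - Z = 1 / (1 + T)\<close>.\<close>

lemma block_rate_balance:
  assumes K: "block_map K" and \<theta>: "\<And>i. 0 < \<theta> i" and l: "\<And>i. 0 < l $ i"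
  shows "(\<theta> i + (\<Sum>j\<in>K i. l $ j)) * block_rate \<theta> K l i + l $ i * (\<Sum>j\<in>K i. block_rate \<theta> K l j) = l $ i"
proof -
  define L where "L = (\<Sum>j\<in>K i. l $ j)"
  define T where "T = (\<Sum>k\<in>K i. l $ k * inverse (\<theta> k + L))"
  have L: "0 \<le> L" unfolding L_def using l by (simp add: sum_nonneg less_imp_le)
  have T: "0 \<le> T" unfolding T_def using l \<theta> L
    by (intro sum_nonneg mult_nonneg_nonneg) (auto simp: less_imp_le intro!: add_nonneg_nonneg)
  have z: "block_rate \<theta> K l j = l $ j * inverse (\<theta> j + L) * inverse (1 + T)" if "j \<in> K i" for j
    using K that unfolding block_rate_def L_def T_def block_map_def by auto
  have "i \<in> K i" using K by (simp add: block_map_def)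
  moreover have "(\<Sum>j\<in>K i. block_rate \<theta> K l j) = T * inverse (1 + T)"
    by (simp add: z T_def sum_distrib_right)
  moreover have "(\<theta> i + L) * inverse (\<theta> i + L) = 1" "(1 + T) * inverse (1 + T) = 1"
    using \<theta>[of i] L T by auto
  ultimately show ?thesis unfolding L_def[symmetric]
    by (simp only: z) algebra
qed

lemma sum_if_mem: "(\<Sum>j\<in>UNIV. if j \<in> A then f j else 0) = (\<Sum>j\<in>A. f j)"
  for f :: "'n::finite \<Rightarrow> real"
  by (simp add: sum.If_cases)

lemma block_feasible:
  assumes K: "block_map K" and \<theta>: "\<And>i. 0 < \<theta> i" and l: "\<And>i. 0 < l $ i"
  shows "lp_feasible \<theta> l (\<lambda>i j. if j \<in> K i then l $ j * block_rate \<theta> K l i else 0)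
           (\<lambda>i. \<theta> i * block_rate \<theta> K l i)"
proof -
  have z: "0 \<le> block_rate \<theta> K l i" for i by (rule block_rate_nonneg) (use \<theta> l in auto)
  have "(\<Sum>j\<in>UNIV. if i \<in> K j then l $ i * block_rate \<theta> K l j else 0)
      + (\<Sum>j\<in>UNIV. if j \<in> K i then l $ j * block_rate \<theta> K l i else 0)
      + \<theta> i * block_rate \<theta> K l i = l $ i" for i
    \<comment> \<open>By symmetry of block membership the incoming matches of \<open>i\<close> also
      form a sum over \<open>K i\<close>.\<close>
    unfolding block_map_sym[OF K, of i] sum_if_mem
    using block_rate_balance[OF K, where \<theta> = \<theta> and l = l and i = i, OF \<theta> l]
    by (simp add: sum_distrib_left[symmetric] sum_distrib_right[symmetric] algebra_simps)
  then show ?thesis unfolding lp_feasible_def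
    using z \<theta> l by (auto simp: less_imp_le)
qed

lemma block_objective:
  "lp_objective c1 c2 (\<lambda>i j. if j \<in> K i then l $ j * block_rate \<theta> K l i else 0)
     (\<lambda>i. \<theta> i * block_rate \<theta> K l i) = block_cost c1 c2 \<theta> K l"
proof -
  have "(\<Sum>j\<in>UNIV. c2 i j * (if j \<in> K i then l $ j * block_rate \<theta> K l i else 0))
      = block_rate \<theta> K l i * (\<Sum>j\<in>K i. c2 i j * l $ j)" for i
    unfolding if_distrib[of "(*) _"] mult_zero_right sum_if_mem sum_distrib_left
    by (simp add: mult_ac)
  then show ?thesis unfolding lp_objective_def block_cost_def
    by (simp add: sum.distrib[symmetric] algebra_simps)
qed

lemma lp_value_le_block_cost:
  assumes c: "\<And>i. 0 \<le> c1 i" "\<And>i j. 0 \<le> c2 i j"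
    and K: "block_map K" and \<theta>: "\<And>i. 0 < \<theta> i" and l: "\<And>i. 0 < l $ i"
  shows "lp_value c1 c2 \<theta> l \<le> block_cost c1 c2 \<theta> K l"
  unfolding lp_value_def
proof (rule cInf_lower)
  show "block_cost c1 c2 \<theta> K l \<in> {lp_objective c1 c2 x y |x y. lp_feasible \<theta> l x y}"
    using block_feasible[OF K, where \<theta> = \<theta> and l = l, OF \<theta> l] block_objective[of c1 c2 K l \<theta>] by (smt (verit) mem_Collect_eq)
  \<comment> \<open>A real \<open>Inf\<close> is guaranteed to be a lower bound only when the set is
    bounded below; nonnegative costs provide the bound 0.\<close>
  show "bdd_below {lp_objective c1 c2 x y |x y. lp_feasible \<theta> l x y}"
    using c by (intro bdd_belowI[of _ 0])
      (auto simp: lp_objective_def lp_feasible_def intro!: add_nonneg_nonneg sum_nonneg)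
qed

section \<open>Weak duality and an optimality certificate\<close>

lemma lp_weak_duality:
  assumes f: "lp_feasible \<theta> l x y"
    and b: "\<And>i j. 0 \<le> \<beta> i j"
    and d1: "\<And>i j. \<alpha> i + \<alpha> j - \<theta> i * \<beta> i j \<le> c2 i j"
    and d2: "\<And>i. \<alpha> i + (\<Sum>j\<in>UNIV. l $ j * \<beta> i j) \<le> c1 i"
  shows "(\<Sum>i\<in>UNIV. \<alpha> i * l $ i) \<le> lp_objective c1 c2 x y"
proof -
  have x: "0 \<le> x i j" and y: "0 \<le> y i" and cap: "\<theta> i * x i j \<le> l $ j * y i"
    and bal: "l $ i = (\<Sum>j\<in>UNIV. x j i) + (\<Sum>j\<in>UNIV. x i j) + y i" for i j
    using f unfolding lp_feasible_def by auto
  \<comment> \<open>Reindexing charges both prices, \<open>\<alpha> i\<close> and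
    \<open>\<alpha> j\<close>, to the single variable \<open>x i j\<close>.\<close>
  have sw: "(\<Sum>i\<in>UNIV. \<Sum>j\<in>UNIV. \<alpha> i * x j i) = (\<Sum>i\<in>UNIV. \<Sum>j\<in>UNIV. \<alpha> j * x i j)"
    by (rule sum.swap)
  have "(\<Sum>i\<in>UNIV. \<alpha> i * l $ i)
      = (\<Sum>i\<in>UNIV. (\<Sum>j\<in>UNIV. \<alpha> i * x j i) + (\<Sum>j\<in>UNIV. \<alpha> i * x i j) + \<alpha> i * y i)"
    unfolding bal by (simp add: sum_distrib_left distrib_left)
  also have "\<dots> = (\<Sum>i\<in>UNIV. (\<Sum>j\<in>UNIV. (\<alpha> i + \<alpha> j) * x i j) + \<alpha> i * y i)"
    by (simp add: sum.distrib sw algebra_simps)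
  also have "\<dots> \<le> (\<Sum>i\<in>UNIV. (\<Sum>j\<in>UNIV. c2 i j * x i j) + c1 i * y i)"
  proof (rule sum_mono)
    fix i
    \<comment> \<open>The prices may exceed the cost by \<open>\<theta> i * \<beta> i j\<close>; the
      capacity constraint passes this excess on to \<open>y i\<close>.\<close>
    have "(\<alpha> i + \<alpha> j) * x i j \<le> c2 i j * x i j + l $ j * \<beta> i j * y i" for j
    proof -
      have "(\<alpha> i + \<alpha> j) * x i j \<le> (c2 i j + \<theta> i * \<beta> i j) * x i j"
        using d1[of i j] x by (intro mult_right_mono) auto
      also have "\<dots> = c2 i j * x i j + \<beta> i j * (\<theta> i * x i j)" by (simp add: algebra_simps)
      also have "\<dots> \<le> c2 i j * x i j + \<beta> i j * (l $ j * y i)"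
        using cap b by (intro add_left_mono mult_left_mono) auto
      finally show ?thesis by (simp add: mult_ac)
    qed
    then have "(\<Sum>j\<in>UNIV. (\<alpha> i + \<alpha> j) * x i j)
        \<le> (\<Sum>j\<in>UNIV. c2 i j * x i j + l $ j * \<beta> i j * y i)"
      by (rule sum_mono)
    also have "\<dots> = (\<Sum>j\<in>UNIV. c2 i j * x i j) + (\<Sum>j\<in>UNIV. l $ j * \<beta> i j) * y i"
      by (simp add: sum.distrib sum_distrib_right)
    finally show "(\<Sum>j\<in>UNIV. (\<alpha> i + \<alpha> j) * x i j) + \<alpha> i * y i
        \<le> (\<Sum>j\<in>UNIV. c2 i j * x i j) + c1 i * y i"
      using mult_right_mono[OF d2[of i] y[of i]] by (simp add: distrib_right)
  qed
  also have "\<dots> = lp_objective c1 c2 x y"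
    by (simp add: lp_objective_def sum.distrib)
  finally show ?thesis .
qed

text \<open>
  \<open>\<alpha>\<close> prices the balance equations; the capacity prices are the positive parts
  \<open>(\<alpha> i + \<alpha> j - c2 i j)\<^sup>+ / \<theta> i\<close>, supported on the blocks. Hypothesis \<open>tight\<close> is the
  dual constraint of \<open>y i\<close> with equality.
\<close>

lemma lp_value_eq_block_cost:
  assumes c: "\<And>i. 0 \<le> c1 i" "\<And>i j. 0 \<le> c2 i j"
    and K: "block_map K" and \<theta>: "\<And>i. 0 < \<theta> i" and l: "\<And>i. 0 < l $ i"
    and inside: "\<And>i j. j \<in> K i \<Longrightarrow> c2 i j \<le> \<alpha> i + \<alpha> j"
    and out: "\<And>i j. j \<notin> K i \<Longrightarrow> \<alpha> i + \<alpha> j \<le> c2 i j"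
    and tight: "\<And>i. \<theta> i * (c1 i - \<alpha> i) = (\<Sum>j\<in>K i. l $ j * (\<alpha> i + \<alpha> j - c2 i j))"
  shows "lp_value c1 c2 \<theta> l = block_cost c1 c2 \<theta> K l"
proof (rule antisym)
  show "lp_value c1 c2 \<theta> l \<le> block_cost c1 c2 \<theta> K l"
    by (rule lp_value_le_block_cost) (use c K \<theta> l in auto)
next
  define z where "z = block_rate \<theta> K l"
  define \<beta> where "\<beta> i j = (if j \<in> K i then (\<alpha> i + \<alpha> j - c2 i j) / \<theta> i else 0)" for i j
  have d2: "\<alpha> i + (\<Sum>j\<in>UNIV. l $ j * \<beta> i j) = c1 i" for i
  proof -
    have "\<theta> i * (\<Sum>j\<in>UNIV. l $ j * \<beta> i j) = \<theta> i * (c1 i - \<alpha> i)"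
      unfolding \<beta>_def if_distrib[of "(*) _"] mult_zero_right sum_if_mem tight sum_distrib_left
      using \<theta>[of i] by (intro sum.cong) auto
    then show ?thesis using \<theta>[of i] by auto
  qed
  have sw: "(\<Sum>i\<in>UNIV. \<Sum>j\<in>K i. \<alpha> i * l $ i * z j) = (\<Sum>i\<in>UNIV. \<Sum>j\<in>K i. \<alpha> j * l $ j * z i)"
  proof -
    have "(\<Sum>i\<in>UNIV. \<Sum>j\<in>K i. \<alpha> i * l $ i * z j)
        = (\<Sum>i\<in>UNIV. \<Sum>j\<in>UNIV. if j \<in> K i then \<alpha> i * l $ i * z j else 0)"
      by (simp add: sum_if_mem)
    also have "\<dots> = (\<Sum>j\<in>UNIV. \<Sum>i\<in>UNIV. if j \<in> K i then \<alpha> i * l $ i * z j else 0)"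
      by (rule sum.swap)
    also have "\<dots> = (\<Sum>j\<in>UNIV. \<Sum>i\<in>K j. \<alpha> i * l $ i * z j)"
      by (subst block_map_sym[OF K]) (simp add: sum_if_mem)
    finally show ?thesis .
  qed
  \<comment> \<open>Complementary slackness: \<open>tight\<close> trades all costs for prices,
    symmetry of the blocks gathers the terms carrying \<open>\<alpha> i\<close>, and the balance
    equation reduces their sum to the dual value.\<close>
  have "block_cost c1 c2 \<theta> K l
      = (\<Sum>i\<in>UNIV. z i * (\<theta> i * \<alpha> i + \<theta> i * (c1 i - \<alpha> i) + (\<Sum>j\<in>K i. c2 i j * l $ j)))"
    unfolding block_cost_def z_def by (simp add: algebra_simps)
  also have "\<dots> = (\<Sum>i\<in>UNIV. z i * (\<theta> i * \<alpha> i + (\<Sum>j\<in>K i. l $ j * (\<alpha> i + \<alpha> j))))"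
    unfolding tight by (simp add: sum.distrib[symmetric] add.assoc algebra_simps)
  also have "\<dots> = (\<Sum>i\<in>UNIV. \<alpha> i * (\<theta> i + (\<Sum>j\<in>K i. l $ j)) * z i) + (\<Sum>i\<in>UNIV. \<Sum>j\<in>K i. \<alpha> j * l $ j * z i)"
    by (simp add: sum.distrib algebra_simps sum_distrib_left)
  also have "\<dots> = (\<Sum>i\<in>UNIV. \<alpha> i * (\<theta> i + (\<Sum>j\<in>K i. l $ j)) * z i + \<alpha> i * (l $ i * (\<Sum>j\<in>K i. z j)))"
    unfolding sw[symmetric] by (simp add: sum.distrib algebra_simps sum_distrib_left)
  also have "\<dots> = (\<Sum>i\<in>UNIV. \<alpha> i * l $ i)"
    using block_rate_balance[OF K, where \<theta> = \<theta> and l = l, OF \<theta> l] unfolding z_def mult.assoc distrib_left[symmetric] by simp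
  finally have cost: "block_cost c1 c2 \<theta> K l = (\<Sum>i\<in>UNIV. \<alpha> i * l $ i)" .
  show "block_cost c1 c2 \<theta> K l \<le> lp_value c1 c2 \<theta> l"
    unfolding lp_value_def
  proof (rule cInf_greatest)
    show "{lp_objective c1 c2 x y |x y. lp_feasible \<theta> l x y} \<noteq> {}"
      using block_feasible[OF K, where \<theta> = \<theta> and l = l, OF \<theta> l] by auto
    fix v assume "v \<in> {lp_objective c1 c2 x y |x y. lp_feasible \<theta> l x y}"
    then obtain x y where v: "v = lp_objective c1 c2 x y" "lp_feasible \<theta> l x y" by blast
    show "block_cost c1 c2 \<theta> K l \<le> v" unfolding cost v(1)
    proof (rule lp_weak_duality[OF v(2)])
      show "0 \<le> \<beta> i j" for i j using inside[of j i] \<theta>[of i] by (simp add: \<beta>_def)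
      show "\<alpha> i + \<alpha> j - \<theta> i * \<beta> i j \<le> c2 i j" for i j
        using out[of j i] \<theta>[of i] by (simp add: \<beta>_def)
      show "\<alpha> i + (\<Sum>j\<in>UNIV. l $ j * \<beta> i j) \<le> c1 i" for i using d2[of i] by simp
    qed
  qed
qed

text \<open>The cost is rational in \<open>l\<close>, and positivity of \<open>l\<close> keeps its
  denominators above \<open>\<theta> k\<close> and above 1 uniformly on \<open>S\<close>.\<close>

lemma quad_approx_on_block_cost:
  assumes \<theta>: "\<And>i. 0 < \<theta> i" and S: "bounded S" and l: "\<And>l i. l \<in> S \<Longrightarrow> 0 < l $ i"
  shows "quad_approx_on S (block_cost c1 c2 \<theta> K)"
proof -
  have nth: "quad_approx_on S (\<lambda>l. l $ i)" for i
    using quad_approx_on_inner[OF S, of "axis i 1"] by (simp add: inner_axis' )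
  have L: "0 \<le> (\<Sum>j\<in>K i. l $ j)" if "l \<in> S" for i l
    using l[OF that] by (simp add: sum_nonneg less_imp_le)
  have inv: "quad_approx_on S (\<lambda>l. inverse (\<theta> k + (\<Sum>j\<in>K i. l $ j)))" for i k
    by (rule quad_approx_on_inverse[OF _ \<theta>[of k]])
      (use L in \<open>auto intro!: quad_approx_on_add quad_approx_on_const quad_approx_on_sum nth\<close>)
  have "quad_approx_on S (\<lambda>l. inverse (1 + (\<Sum>k\<in>K i. l $ k * inverse (\<theta> k + (\<Sum>j\<in>K i. l $ j)))))" for i
  proof (rule quad_approx_on_inverse[where m = 1])
    show "1 \<le> 1 + (\<Sum>k\<in>K i. l $ k * inverse (\<theta> k + (\<Sum>j\<in>K i. l $ j)))" if "l \<in> S" for l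
      using L[OF that] l[OF that] \<theta>
      by (auto simp: less_imp_le intro!: sum_nonneg mult_nonneg_nonneg add_nonneg_nonneg)
  qed (auto intro!: quad_approx_on_add quad_approx_on_const quad_approx_on_sum quad_approx_on_mult nth inv)
  then show ?thesis
    unfolding block_cost_def block_rate_def
    by (intro quad_approx_on_sum quad_approx_on_mult quad_approx_on_add quad_approx_on_const nth inv)
qed

section \<open>Block prices\<close>

text \<open>For a pair \<open>i\<close>, \<open>j\<close> it is used with \<open>p\<close>,
  \<open>q\<close> the parameters, \<open>u\<close>, \<open>v\<close> the entries of
  \<open>l\<close>, \<open>a\<close>, \<open>b\<close> the self-matching costs, \<open>c\<close> the
  pair cost and \<open>w\<close> the pair slack. The conclusion then says that
  \<open>2 * \<alpha> i - c1 i\<close> is nonnegative.\<close>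

lemma pair_weight_bound:
  fixes p q u v a b c w :: real
  assumes pos: "0 < p" "0 < q" "0 < u" "0 < v" "0 < a" and q: "q \<le> 2 * p" and ac: "a \<le> c" and bc: "b \<le> c"
    and w: "w * (1 + v / (p + 2 * u) + u / (q + 2 * v))
      = a * (p + u) / (p + 2 * u) + b * (q + v) / (q + 2 * v) - c"
  shows "2 * v * w \<le> p * a"
proof -
  define P Q where "P = p + 2 * u" and "Q = q + 2 * v"
  define D where "D = 1 + v / P + u / Q"
  have PQ: "0 < P" "0 < Q" unfolding P_def Q_def using pos by auto
  have D: "0 < D" unfolding D_def using pos PQ by (intro add_pos_pos) auto
  have vQ: "0 \<le> v / Q" "v / Q \<le> 1" using PQ pos by (auto simp: Q_def)
  have "w * D = a * (p + u) / P + b * (q + v) / Q - c"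
    using w by (simp add: P_def Q_def D_def)
  also have "\<dots> = (a + b - c) - a * (u / P) - b * (v / Q)"
    using PQ by (simp add: field_simps) (simp add: P_def Q_def algebra_simps)
  \<comment> \<open>Since \<open>a \<le> c\<close>, the coefficient \<open>b\<close> may drop to
    \<open>a + b - c\<close>, which makes \<open>1 - v / Q\<close> a common factor;
    \<open>b \<le> c\<close> then bounds \<open>a + b - c\<close> by \<open>a\<close>.\<close>
  also have "\<dots> \<le> (a + b - c) - a * (u / P) - (a + b - c) * (v / Q)"
    using mult_right_mono[of "a + b - c" b "v / Q"] vQ ac by linarith
  also have "\<dots> = (a + b - c) * (1 - v / Q) - a * (u / P)" by (simp add: algebra_simps)
  also have "\<dots> \<le> a * (1 - v / Q) - a * (u / P)"
    using vQ bc by (intro diff_right_mono mult_right_mono) auto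
  finally have wD: "w * D \<le> a * (1 - v / Q - u / P)" by (simp add: algebra_simps)
  \<comment> \<open>The two nonnegative products below add up exactly to the right side minus the
    left side. The ratio bound \<open>q \<le> 2 * p\<close> enters only in the first.\<close>
  have "2 * v * (P * Q - v * P - u * Q) \<le> p * (P * Q + v * Q + u * P)"
  proof -
    have "0 \<le> (2 * p - q) * (u * v * 2 + p * v)" using q pos by (intro mult_nonneg_nonneg) auto
    moreover have "0 \<le> p * (p * q + 2 * u * q + u * p + 2 * u * u)" using pos by simp
    ultimately show ?thesis unfolding P_def Q_def by (simp add: algebra_simps)
  qed
  then have "2 * v * ((1 - v / Q - u / P) * (P * Q)) \<le> p * (D * (P * Q))"
    using PQ by (simp add: D_def algebra_simps)
  then have "2 * v * (1 - v / Q - u / P) * (P * Q) \<le> p * D * (P * Q)" by (simp add: mult.assoc)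
  then have "2 * v * (1 - v / Q - u / P) \<le> p * D"
    using PQ by (simp add: mult_le_cancel_right)
  then have "a * (2 * v * (1 - v / Q - u / P)) \<le> a * (p * D)" using pos by (intro mult_left_mono) auto
  moreover have "2 * v * (w * D) \<le> 2 * v * (a * (1 - v / Q - u / P))"
    using wD pos by (intro mult_left_mono) auto
  ultimately have "2 * v * w * D \<le> p * a * D" by (simp add: mult_ac)
  then show ?thesis using D by simp
qed

text \<open>The solution \<open>\<alpha>\<close> of \<open>\<theta> i * (c1 i - \<alpha>) = l $ i * (2 * \<alpha> - c1 i)\<close>.\<close>

definition single_price :: "('n::finite \<Rightarrow> real) \<Rightarrow> ('n \<Rightarrow> real) \<Rightarrow> real^'n \<Rightarrow> 'n \<Rightarrow> real" where
  "single_price c1 \<theta> l i = c1 i * (\<theta> i + l $ i) / (\<theta> i + 2 * l $ i)"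

lemma block_map_matching:
  assumes "\<And>i j. M i j \<Longrightarrow> M j i" and "\<And>i j k. M i j \<Longrightarrow> M i k \<Longrightarrow> j = k"
  shows "block_map (\<lambda>i. insert i {j. M i j})"
  unfolding block_map_def using assms by blast

text \<open>
  On a two-element block \<open>{i, j}\<close> the tight dual constraints are linear, and \<open>w i j\<close> below
  is the resulting value of \<open>\<alpha> i + \<alpha> j - c2 i j\<close>. The ratio bound on \<open>\<theta>\<close> keeps both
  self-matching prices \<open>2 * \<alpha> i - c1 i\<close> nonnegative.
\<close>

lemma lp_value_eq_matching_cost:
  fixes M :: "'n::finite \<Rightarrow> 'n \<Rightarrow> bool"
  assumes c1: "\<And>i. 0 < c1 i" and diag: "\<And>i. c1 i = c2 i i" and le: "\<And>i j. c1 i \<le> c2 i j"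
    and csym: "\<And>i j. c2 i j = c2 j i"
    and \<theta>: "\<And>i. 0 < \<theta> i" and ratio: "\<And>i j. \<theta> j \<le> 2 * \<theta> i" and l: "\<And>i. 0 < l $ i"
    and sym: "\<And>i j. M i j \<Longrightarrow> M j i" and irrefl: "\<And>i. \<not> M i i"
    and unique: "\<And>i j k. M i j \<Longrightarrow> M i k \<Longrightarrow> j = k"
    and active: "\<And>i j. M i j \<Longrightarrow> c2 i j \<le> single_price c1 \<theta> l i + single_price c1 \<theta> l j"
    and inactive: "\<And>i j. i \<noteq> j \<Longrightarrow> \<not> M i j \<Longrightarrow> single_price c1 \<theta> l i + single_price c1 \<theta> l j \<le> c2 i j"
  shows "lp_value c1 c2 \<theta> l = block_cost c1 c2 \<theta> (\<lambda>i. insert i {j. M i j}) l"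
proof -
  let ?K = "\<lambda>i. insert i {j. M i j}"
  have K: "block_map ?K"
    using sym unique by (rule block_map_matching)
  define s where "s = single_price c1 \<theta> l"
  define P where "P i = \<theta> i + 2 * l $ i" for i
  \<comment> \<open>The tight constraint of \<open>i\<close> gives
    \<open>\<alpha> i = s i - l $ j * w / P i\<close>, and likewise for \<open>j\<close>. Adding
    both and subtracting \<open>c2 i j\<close> yields a linear equation for \<open>w\<close> with
    this solution.\<close>
  define w where "w i j = (s i + s j - c2 i j) / (1 + l $ j / P i + l $ i / P j)" for i j
  \<comment> \<open>The sum has at most one term, so one formula covers pairs and, with an empty
    sum, singletons.\<close>
  define \<alpha> where "\<alpha> i = s i - (\<Sum>j | M i j. l $ j * w i j) / P i" for i
  have P: "0 < P i" for i unfolding P_def using \<theta>[of i] l[of i] by simp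
  have sP: "s i * P i = c1 i * (\<theta> i + l $ i)" for i
    using P[of i] by (simp add: s_def single_price_def P_def)
  have D: "0 < 1 + l $ j / P i + l $ i / P j" for i j
    using P l by (intro add_pos_pos) auto
  have wD: "w i j * (1 + l $ j / P i + l $ i / P j) = s i + s j - c2 i j" for i j
    using D[of j i] by (simp add: w_def)
  have wsym: "w i j = w j i" for i j
    unfolding w_def csym[of i j] by (simp add: add_ac)
  have w0: "0 \<le> w i j" if "M i j" for i j
    using active[OF that] D[of j i] by (simp add: w_def s_def)
  have \<alpha>_le: "\<alpha> i \<le> s i" for i
    using w0 l P[of i] by (auto simp: \<alpha>_def less_imp_le intro!: sum_nonneg divide_nonneg_pos)
  have set1: "{k. M i k} = {j}" if "M i j" for i j using that unique by blast
  have \<alpha>_pair: "\<alpha> i = s i - l $ j * w i j / P i" if "M i j" for i j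
    by (simp add: \<alpha>_def set1[OF that])
  have \<alpha>_single: "\<alpha> i = s i" if "\<And>j. \<not> M i j" for i
    using that by (simp add: \<alpha>_def)
  have slack: "\<alpha> i + \<alpha> j - c2 i j = w i j" if "M i j" for i j
    using wD[of i j] unfolding \<alpha>_pair[OF that] \<alpha>_pair[OF sym[OF that]] wsym[of j i]
    by (simp add: algebra_simps)
  have tight: "\<theta> i * (c1 i - \<alpha> i) = (\<Sum>j\<in>?K i. l $ j * (\<alpha> i + \<alpha> j - c2 i j))" for i
  proof (cases "\<exists>j. M i j")
    case True
    then obtain j where j: "M i j" by blast
    have ij: "i \<noteq> j" using j irrefl by auto
    have "\<alpha> i * P i = s i * P i - l $ j * w i j"
      using P[of i] by (simp add: \<alpha>_pair[OF j] left_diff_distrib)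
    then show ?thesis
      unfolding set1[OF j] using ij slack[OF j]
      by (simp add: sP) (simp add: P_def diag[symmetric] algebra_simps)
  next
    case False
    then have "\<alpha> i * P i = c1 i * (\<theta> i + l $ i)" and e: "{j. M i j} = {}"
      using \<alpha>_single sP by auto
    then show ?thesis by (simp add: P_def diag[symmetric] algebra_simps)
  qed
  \<comment> \<open>Each \<open>i\<close> lies in its own block, so the certificate requires this.
    For a paired \<open>i\<close>, multiplication by \<open>P i\<close> turns the difference into
    \<open>\<theta> i * c1 i - 2 * l $ j * w i j\<close>.\<close>
  have half: "c1 i \<le> 2 * \<alpha> i" for i
  proof -
    have "0 \<le> P i * (2 * \<alpha> i - c1 i)"
    proof (cases "\<exists>j. M i j")
      case True
      then obtain j where j: "M i j" by blast
      have "2 * l $ j * w i j \<le> \<theta> i * c1 i"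
      proof (rule pair_weight_bound[of _ "\<theta> j" "l $ i" _ _ "c2 i j" "c1 j"])
        show "w i j * (1 + l $ j / (\<theta> i + 2 * l $ i) + l $ i / (\<theta> j + 2 * l $ j)) =
            c1 i * (\<theta> i + l $ i) / (\<theta> i + 2 * l $ i) + c1 j * (\<theta> j + l $ j) / (\<theta> j + 2 * l $ j) - c2 i j"
          using wD[of i j] by (simp add: s_def single_price_def P_def)
        show "c1 j \<le> c2 i j" using le[of j i] csym[of i j] by simp
      qed (use \<theta> l c1 le ratio in auto)
      moreover have "\<alpha> i * P i = c1 i * (\<theta> i + l $ i) - l $ j * w i j"
        unfolding sP[symmetric] using P[of i] by (simp add: \<alpha>_pair[OF j] left_diff_distrib)
      ultimately show ?thesis by (simp add: P_def algebra_simps)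
    next
      case False
      then have "\<alpha> i * P i = c1 i * (\<theta> i + l $ i)" using \<alpha>_single sP by auto
      moreover have "0 \<le> \<theta> i * c1 i" using \<theta>[of i] c1[of i] by simp
      ultimately show ?thesis by (simp add: P_def algebra_simps)
    qed
    then show ?thesis using P[of i] by (simp add: zero_le_mult_iff)
  qed
  show "lp_value c1 c2 \<theta> l = block_cost c1 c2 \<theta> ?K l"
  proof (rule lp_value_eq_block_cost[where \<alpha> = \<alpha>, OF _ _ K \<theta> l _ _ tight])
    show "0 \<le> c1 i" for i using c1[of i] by simp
    show "0 \<le> c2 i j" for i j using c1[of i] le[of i j] by simp
    show "c2 i j \<le> \<alpha> i + \<alpha> j" if "j \<in> ?K i" for i j
      using that half[of i] slack[of i j] w0[of i j] diag[of i] by auto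
    \<comment> \<open>Pairing only lowers prices, so comparing the single prices with
      \<open>c2 i j\<close> suffices.\<close>
    show "\<alpha> i + \<alpha> j \<le> c2 i j" if "j \<notin> ?K i" for i j
      using that inactive[of i j] \<alpha>_le[of i] \<alpha>_le[of j] by (auto simp: s_def)
  qed
qed

section \<open>Critical efficiency\<close>

text \<open>In a descending list every entry strictly above position \<open>k\<close> in value
  stands before it.\<close>

lemma length_filter_greater_nth:
  fixes xs :: "'a::linorder list"
  assumes "sorted_wrt (\<ge>) xs" "k < length xs"
  shows "length (filter (\<lambda>v. xs ! k < v) xs) \<le> k"
proof -
  have "xs ! (k + m) \<le> xs ! k" if "k + m < length xs" for m
    using assms that by (cases m) (auto simp: sorted_wrt_iff_nth_less)
  then have "filter (\<lambda>v. xs ! k < v) (drop k xs) = []"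
    using assms by (auto simp: filter_empty_conv in_set_conv_nth not_less)
  then have "filter (\<lambda>v. xs ! k < v) xs = filter (\<lambda>v. xs ! k < v) (take k xs)"
    by (metis append.right_neutral append_take_drop_id filter_append)
  then show ?thesis using length_filter_le[of _ "take k xs"] by (metis length_take min.bounded_iff)
qed

lemma
  fixes c1 :: "'n::finite \<Rightarrow> real"
  assumes "1 \<le> k" "k \<le> CARD('n)"
  shows card_greater_sorted_efficiency:
      "card {j. sorted_efficiency c1 c2 i k < efficiency c1 c2 i j} < k" (is ?card)
    and sorted_efficiency_in_range:
      "sorted_efficiency c1 c2 i k \<in> range (efficiency c1 c2 i)" (is ?range)
proof -
  define E where "E = image_mset (efficiency c1 c2 i) (mset_set UNIV)"
  define xs where "xs = rev (sorted_list_of_multiset E)"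
  have mset: "mset xs = E" by (simp add: xs_def)
  have len: "length xs = CARD('n)"
    using arg_cong[OF mset, of size] by (simp add: E_def)
  have se: "sorted_efficiency c1 c2 i k = xs ! (k - 1)"
    by (simp add: sorted_efficiency_def xs_def E_def)
  have k: "k - 1 < length xs" using assms len by simp
  have "sorted_wrt (\<ge>) xs"
    by (simp add: xs_def sorted_wrt_rev)
  then have "length (filter (\<lambda>v. xs ! (k - 1) < v) xs) \<le> k - 1"
    using k by (rule length_filter_greater_nth)
  moreover have "length (filter (\<lambda>v. xs ! (k - 1) < v) xs)
      = size (filter_mset (\<lambda>v. xs ! (k - 1) < v) E)"
    unfolding mset[symmetric] mset_filter[symmetric] size_mset ..
  moreover have "\<dots> = card {j. xs ! (k - 1) < efficiency c1 c2 i j}"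
    by (simp add: E_def filter_mset_image_mset)
  ultimately show ?card using assms by (simp add: se)
  have "set xs = range (efficiency c1 c2 i)"
    using arg_cong[OF mset, of set_mset] by (simp add: E_def)
  then show ?range unfolding se using nth_mem[OF k] by simp
qed

lemma efficiency_le_half:
  assumes "0 < c1 i" "0 < c1 j" "c1 i \<le> c2 i j" "c1 j \<le> c2 i j"
  shows "efficiency c1 c2 i j \<le> 1 / 2"
  using assms by (simp add: efficiency_def field_simps)

lemma efficiency_le_iff:
  assumes "0 < c1 i" "0 < c1 j"
  shows "efficiency c1 c2 i j \<le> e \<longleftrightarrow> (c1 i + c1 j) * (1 - e) \<le> c2 i j"
  using assms by (simp add: efficiency_def field_simps)

text \<open>Together with the assumption that the third value differs from 1/2, this makes
  \<open>1 - 2 * e\<close> positive.\<close>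

lemma critical_efficiency_le_half:
  fixes c1 :: "'n::finite \<Rightarrow> real"
  assumes "1 \<le> k" "\<And>i. 0 < c1 i" "\<And>i j. c1 i \<le> c2 i j" "\<And>i j. c2 i j = c2 j i"
  shows "critical_efficiency c1 c2 k \<le> 1 / 2"
proof (cases "k \<le> CARD('n)")
  case True
  have "sorted_efficiency c1 c2 i k \<le> 1 / 2" for i
  proof -
    obtain j where "sorted_efficiency c1 c2 i k = efficiency c1 c2 i j"
      using sorted_efficiency_in_range[OF assms(1) True] by blast
    then show ?thesis using efficiency_le_half[of c1 i j c2] assms by metis
  qed
  then have "Max (range (\<lambda>i. sorted_efficiency c1 c2 i k)) \<le> 1 / 2"
    by (intro Max.boundedI) auto
  then show ?thesis using True by (simp add: critical_efficiency_def)
qed (simp add: critical_efficiency_def)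

text \<open>Since \<open>i\<close> itself has efficiency \<open>1/2\<close>, only one other index can exceed the third value.\<close>

lemma unique_critical_partner:
  fixes c1 :: "'n::finite \<Rightarrow> real"
  assumes c1: "\<And>i. 0 < c1 i" and diag: "\<And>i. c1 i = c2 i i"
    and e: "critical_efficiency c1 c2 3 < 1 / 2"
    and j: "j \<noteq> i" "critical_efficiency c1 c2 3 < efficiency c1 c2 i j"
    and k: "k \<noteq> i" "critical_efficiency c1 c2 3 < efficiency c1 c2 i k"
  shows "j = k"
proof (rule ccontr)
  assume "j \<noteq> k"
  then have three: "card {i, j, k} = 3" using j k by auto
  show False
  proof (cases "3 \<le> CARD('n)")
    case True
    have "sorted_efficiency c1 c2 i 3 \<le> critical_efficiency c1 c2 3"
      using True by (simp add: critical_efficiency_def)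
    moreover have "efficiency c1 c2 i i = 1 / 2"
      using c1[of i] diag[of i] by (simp add: efficiency_def field_simps)
    \<comment> \<open>\<open>i\<close> counts itself here with efficiency 1/2, so three indices
      would lie strictly above the third largest value.\<close>
    ultimately have "{i, j, k} \<subseteq> {j. sorted_efficiency c1 c2 i 3 < efficiency c1 c2 i j}"
      using e j k by auto
    from card_mono[OF _ this] show False
      using card_greater_sorted_efficiency[of 3 c1 c2 i] True three by simp
  next
    case False
    then show False using card_mono[of UNIV "{i, j, k}"] three by simp
  qed
qed

section \<open>Choosing the optimal partition at each point of the box\<close>

theorem theorem2:
  fixes c1 :: "'n::{finite,linorder} \<Rightarrow> real"
    and c2 :: "'n::{finite,linorder} \<Rightarrow> 'n::{finite,linorder} \<Rightarrow> real"
    and \<theta> :: "'n::{finite,linorder} \<Rightarrow> real"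
    and \<nu> :: real
    and lo up :: "real^('n::{finite,linorder})"
  assumes c1_pos: "\<And>i. 0 < c1 i"
    and c2_pos: "\<And>i j. 0 < c2 i j"
    and c_diag: "\<And>i. c1 i = c2 i i"
    and c_le: "\<And>i j. c1 i \<le> c2 i j"
    and c_sym: "\<And>i j. c2 i j = c2 j i"
    and theta_pos: "\<And>i. 0 < \<theta> i"
    and theta_mono: "mono \<theta>"
    and nu_def: "\<nu> = \<theta> (Max UNIV) / \<theta> (Min UNIV)"
    and nu_gt: "1 < \<nu>"
    and lo_pos: "\<And>i. 0 < lo $ i"
    and nu_le: "\<nu> \<le> 2"
    and e3: "critical_efficiency c1 c2 3 \<noteq> 1 / 2"
    and lo_gt: "\<And>i. \<theta> i * (critical_efficiency c1 c2 3 / (1 - 2 * critical_efficiency c1 c2 3)) < lo $ i"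
  shows "weakly_concave_on {lo..up} (lp_value c1 c2 \<theta>)"
proof -
  define e where "e = critical_efficiency c1 c2 3"
  have e_half: "e < 1 / 2"
    using critical_efficiency_le_half[of 3 c1 c2] c1_pos c_le c_sym e3
    unfolding e_def by fastforce
  have ratio: "\<theta> j \<le> 2 * \<theta> i" for i j
  proof -
    have "\<theta> j \<le> \<theta> (Max UNIV)" "\<theta> (Min UNIV) \<le> \<theta> i"
      by (auto intro!: monoD[OF theta_mono])
    moreover have "\<theta> (Max UNIV) \<le> 2 * \<theta> (Min UNIV)"
      using nu_le theta_pos[of "Min UNIV"] unfolding nu_def by (simp add: field_simps)
    ultimately show ?thesis by linarith
  qed
  have pos: "0 < l $ i" if "l \<in> {lo..up}" for l i
    using that lo_pos[of i] by (auto simp: less_eq_vec_def intro: less_le_trans)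
  \<comment> \<open>The lower bound on \<open>l\<close> is equivalent to
    \<open>e * (\<theta> i + 2 * l $ i) < l $ i\<close>. The resulting price bound, added for
    \<open>i\<close> and \<open>j\<close>, stays below the cost of any pair with efficiency at most
    \<open>e\<close>.\<close>
  have price: "single_price c1 \<theta> l i \<le> c1 i * (1 - e)" if "l \<in> {lo..up}" for l i
  proof -
    have "\<theta> i * (e / (1 - 2 * e)) < l $ i"
      using that lo_gt[of i] unfolding e_def by (auto simp: less_eq_vec_def intro: less_le_trans)
    then have "e * (\<theta> i + 2 * l $ i) \<le> l $ i"
      using e_half by (simp add: field_simps)
    moreover have "0 < \<theta> i + 2 * l $ i" using pos[OF that, of i] theta_pos[of i] by simp
    ultimately have "(\<theta> i + l $ i) / (\<theta> i + 2 * l $ i) \<le> 1 - e"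
      by (simp add: field_simps)
    then have "c1 i * ((\<theta> i + l $ i) / (\<theta> i + 2 * l $ i)) \<le> c1 i * (1 - e)"
      using c1_pos[of i] by (intro mult_left_mono) auto
    then show ?thesis by (simp add: single_price_def)
  qed
  show ?thesis
  proof (rule weakly_concave_on_finite_min[where I = "Collect block_map" and f = "block_cost c1 c2 \<theta>"])
    show "convex {lo..up}" by (simp add: interval_cbox[symmetric] convex_box)
    show "quad_approx_on {lo..up} (block_cost c1 c2 \<theta> K)" for K
      using quad_approx_on_block_cost[of \<theta> "{lo..up}"] theta_pos pos
      by (metis bounded_cbox interval_cbox)
    show "lp_value c1 c2 \<theta> l \<le> block_cost c1 c2 \<theta> K l"
      if "K \<in> Collect block_map" "l \<in> {lo..up}" for K l
      using that lp_value_le_block_cost[of c1 c2 K \<theta> l] c1_pos c2_pos theta_pos pos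
      by (auto simp: less_imp_le)
    show "\<exists>K\<in>Collect block_map. lp_value c1 c2 \<theta> l = block_cost c1 c2 \<theta> K l"
      if l: "l \<in> {lo..up}" for l
    proof -
      let ?s = "single_price c1 \<theta> l"
      \<comment> \<open>The efficiency condition makes partners unique, and the cost condition makes
        the pair slack nonnegative; the latter depends on \<open>l\<close>.\<close>
      define M where "M i j \<longleftrightarrow> i \<noteq> j \<and> e < efficiency c1 c2 i j \<and> c2 i j \<le> ?s i + ?s j" for i j
      have esym: "efficiency c1 c2 i j = efficiency c1 c2 j i" for i j
        unfolding efficiency_def c_sym[of i j] by (simp add: add.commute)
      have sym: "M j i" if "M i j" for i j
        using that esym[of i j] c_sym[of i j] by (auto simp: M_def add.commute)
      have unique: "j = k" if "M i j" "M i k" for i j k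
        using that e_half unique_critical_partner[of c1 c2 j i k] c1_pos c_diag
        by (auto simp: M_def e_def)
      have inactive: "?s i + ?s j \<le> c2 i j" if "i \<noteq> j" "\<not> M i j" for i j
      proof (cases "e < efficiency c1 c2 i j")
        case False
        then have "(c1 i + c1 j) * (1 - e) \<le> c2 i j"
          using efficiency_le_iff[of c1 i j c2 e] c1_pos by simp
        then show ?thesis using price[OF l, of i] price[OF l, of j] by (simp add: distrib_right)
      qed (use that in \<open>auto simp: M_def\<close>)
      have active: "c2 i j \<le> ?s i + ?s j" if "M i j" for i j
        using that by (simp add: M_def)
      have irrefl: "\<not> M i i" for i by (simp add: M_def)
      let ?K = "\<lambda>i. insert i {j. M i j}"
      have "block_map ?K"
        using sym unique by (rule block_map_matching)
      moreover have "lp_value c1 c2 \<theta> l = block_cost c1 c2 \<theta> ?K l"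
        by (rule lp_value_eq_matching_cost[where M = M])
          (fact c1_pos c_diag c_le c_sym theta_pos ratio pos[OF l] sym irrefl unique active inactive)+
      ultimately show ?thesis by blast
    qed
  qed simp
qed

end
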